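(* Let $n\ge 1$ be an integer, let $m$ be a real number with $m\ge n$, and put $d=n/m$. Let $\mathcal U$ be a nonempty finite set and for each $u\in\mathcal U$ let $\alpha_u\in\mathbb R$ and $\beta_u\in[0,1]$; assume there is $u\in\mathcal U$ with $\beta_u\in(0,1]$. Consider the dynamics of $x^k=(x_1^k,\dots,x_n^k)\in\mathbb R^n$, $k\in\mathbb N$, started from an arbitrary $x^0\in\mathbb R^n$: $$x_i^{k+1}=\begin{cases}\min_{u\in\mathcal U}\{\alpha_u+(1-\beta_u)x_i^k+\beta_u x_{i+1}^k\} & \text{if } 1\le i<n,\\[2pt] \min_{u\in\mathcal U}\{\alpha_u+n\beta_u/d+(1-\beta_u)x_n^k+\beta_u x_1^k\} & \text{if } i=n.\end{cases}$$ Then the fundamental diagram, that is, the average flow $f$ as a function of the density $d$, is $$f=\min_{u\in\mathcal U}\{\alpha_u d+\beta_u\}.$$ Explicitly: for every $i\in\{1,\dots,n\}$ the limit $\bar v=\lim_{k\to\infty}x_i^k/k$ exists, does not depend on $i$ (nor on $x^0$), and the average flow $f:=d\,\bar v$ equals $\min_{u\in\mathcal U}\{\alpha_u d+\beta_u\}$.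
   Context: The setting is $n$ vehicles on a one-lane circular road of length $m$; $d=n/m$ is the car density, and $x_i^k$ is the distance travelled by vehicle $i$ up to time $k$, vehicle $i+1$ being ahead of vehicle $i$ (and vehicle $1$ ahead of vehicle $n$). The average car speed is the common growth rate $\bar v=\lim_{k\to\infty}x_i^k/k$, and the average flow is $f=d\,\bar v$. The fundamental diagram is the relation giving $f$ in terms of $d$. *)

theory Defs
  imports Complex_Main
begin

text \<open>
  A trajectory \<open>x :: nat \<Rightarrow> nat \<Rightarrow> real\<close> gives the distance \<open>x k i\<close> travelled by vehicle \<open>i\<close>
  up to time \<open>k\<close>. The vehicles are numbered \<open>1, ..., n\<close>; values of \<open>x k\<close> at other indices
  are irrelevant.
\<close>

definition car_dynamics ::
  "'u set \<Rightarrow> ('u \<Rightarrow> real) \<Rightarrow> ('u \<Rightarrow> real) \<Rightarrow> nat \<Rightarrow> real \<Rightarrow> (nat \<Rightarrow> nat \<Rightarrow> real) \<Rightarrow> bool" where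
  "car_dynamics U \<alpha> \<beta> n d x \<longleftrightarrow>
     (\<forall>k. (\<forall>i. 1 \<le> i \<and> i < n \<longrightarrow>
             x (Suc k) i = (MIN u\<in>U. \<alpha> u + (1 - \<beta> u) * x k i + \<beta> u * x k (i + 1))) \<and>
          x (Suc k) n =
            (MIN u\<in>U. \<alpha> u + real n * \<beta> u / d + (1 - \<beta> u) * x k n + \<beta> u * x k 1))"

definition has_average_speed :: "nat \<Rightarrow> (nat \<Rightarrow> nat \<Rightarrow> real) \<Rightarrow> real \<Rightarrow> bool" where
  "has_average_speed n x v \<longleftrightarrow> (\<forall>i\<in>{1..n}. (\<lambda>k. x k i / real k) \<longlonglongrightarrow> v)"

definition average_flow :: "real \<Rightarrow> real \<Rightarrow> real" where
  "average_flow d v = d * v"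

end

theory Submission
  imports Defs
begin

text \<open>
  The equally spaced configuration, with gap \<open>1 / d\<close> between consecutive vehicles, is translated
  at each step by \<open>v = (MIN u\<in>U. \<alpha> u + \<beta> u / d)\<close>. Since the weights \<open>1 - \<beta> u\<close> and \<open>\<beta> u\<close> are
  nonnegative and sum to \<open>1\<close>, the dynamics is nonexpansive for the sup norm, so every trajectory
  stays within bounded distance of this one and has the same growth rate.
\<close>

text \<open>A minimiser of one family is a competitor in the other minimum, which gives a one-sided
  bound; exchanging the families gives the other side.\<close>

lemma abs_Min_diff_le:
  fixes f g :: "'a \<Rightarrow> real"
  assumes "finite A" "A \<noteq> {}" and le: "\<And>a. a \<in> A \<Longrightarrow> \<bar>f a - g a\<bar> \<le> C"
  shows "\<bar>(MIN a\<in>A. f a) - (MIN a\<in>A. g a)\<bar> \<le> C"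
proof -
  have *: "(MIN a\<in>A. p a) \<le> (MIN a\<in>A. q a) + C"
    if "\<And>a. a \<in> A \<Longrightarrow> p a \<le> q a + C" for p q :: "'a \<Rightarrow> real"
  proof -
    have "(MIN a\<in>A. q a) \<in> q ` A"
      using assms(1,2) by (intro Min_in) auto
    then obtain a where a: "a \<in> A" "(MIN a\<in>A. q a) = q a" by auto
    have "(MIN a\<in>A. p a) \<le> p a" using a(1) assms(1) by simp
    also have "\<dots> \<le> q a + C" using that a(1) by simp
    finally show ?thesis using a(2) by simp
  qed
  have "f a \<le> g a + C" "g a \<le> f a + C" if "a \<in> A" for a
    using le[OF that] by linarith+
  then show ?thesis using *[of f g] *[of g f] by fastforce
qed

lemma Min_mult_left:
  fixes c :: real
  assumes "finite A" "A \<noteq> {}" "0 \<le> c"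
  shows "c * (MIN a\<in>A. f a) = (MIN a\<in>A. c * f a)"
proof -
  have "mono ((*) c)" using assms(3) by (auto intro: monoI mult_left_mono)
  then show ?thesis
    using mono_Min_commute[of "(*) c" "f ` A"] assms(1,2) by (simp add: image_image)
qed

lemma abs_convex_combination_le:
  fixes b p q C :: real
  assumes "b \<in> {0..1}" "\<bar>p\<bar> \<le> C" "\<bar>q\<bar> \<le> C"
  shows "\<bar>(1 - b) * p + b * q\<bar> \<le> C"
proof -
  have "\<bar>(1 - b) * p + b * q\<bar> \<le> (1 - b) * \<bar>p\<bar> + b * \<bar>q\<bar>"
    using assms(1) abs_triangle_ineq[of "(1 - b) * p" "b * q"] by (simp add: abs_mult)
  also have "\<dots> \<le> C" using assms by (intro convex_bound_le) auto
  finally show ?thesis .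
qed

lemma car_dynamics_nonexpansive:
  assumes U: "finite U" "U \<noteq> {}" and \<beta>: "\<And>u. u \<in> U \<Longrightarrow> \<beta> u \<in> {0..1}" and n: "n \<ge> 1"
    and x: "car_dynamics U \<alpha> \<beta> n d x" and y: "car_dynamics U \<alpha> \<beta> n d y"
    and init: "\<And>i. i \<in> {1..n} \<Longrightarrow> \<bar>x 0 i - y 0 i\<bar> \<le> C"
    and i: "i \<in> {1..n}"
  shows "\<bar>x k i - y k i\<bar> \<le> C"
  using i
proof (induction k arbitrary: i)
  case 0
  then show ?case by (rule init)
next
  case (Suc k)
  \<comment> \<open>The offset \<open>c\<close> and the index \<open>j\<close> of the vehicle ahead
    stay general, so that one estimate covers both the inner vehicles and the wrap-around from
    \<open>n\<close> to \<open>1\<close>. For each \<open>u\<close> the offset cancels in the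
    difference, leaving a convex combination of the deviations at \<open>i\<close> and
    \<open>j\<close>.\<close>
  have step: "\<bar>(MIN u\<in>U. c u + (1 - \<beta> u) * x k i + \<beta> u * x k j) -
      (MIN u\<in>U. c u + (1 - \<beta> u) * y k i + \<beta> u * y k j)\<bar> \<le> C"
    if j: "j \<in> {1..n}" for c j
  proof (rule abs_Min_diff_le[OF U])
    fix u assume "u \<in> U"
    from abs_convex_combination_le[OF \<beta>[OF this] Suc.IH[OF Suc.prems] Suc.IH[OF j]]
    show "\<bar>(c u + (1 - \<beta> u) * x k i + \<beta> u * x k j) -
      (c u + (1 - \<beta> u) * y k i + \<beta> u * y k j)\<bar> \<le> C"
      by (simp add: algebra_simps)
  qed
  show ?case
  proof (cases "i < n")
    case True
    then have "x (Suc k) i = (MIN u\<in>U. \<alpha> u + (1 - \<beta> u) * x k i + \<beta> u * x k (i + 1))"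
      "y (Suc k) i = (MIN u\<in>U. \<alpha> u + (1 - \<beta> u) * y k i + \<beta> u * y k (i + 1))"
      using x y Suc.prems by (simp_all add: car_dynamics_def)
    moreover have "i + 1 \<in> {1..n}" using True by simp
    ultimately show ?thesis using step[of "i + 1" \<alpha>] by argo
  next
    case False
    then have i: "i = n" using Suc.prems by simp
    have "x (Suc k) i =
        (MIN u\<in>U. \<alpha> u + real n * \<beta> u / d + (1 - \<beta> u) * x k i + \<beta> u * x k 1)"
      "y (Suc k) i =
        (MIN u\<in>U. \<alpha> u + real n * \<beta> u / d + (1 - \<beta> u) * y k i + \<beta> u * y k 1)"
      using x y unfolding i by (simp_all add: car_dynamics_def)
    moreover have "1 \<in> {1..n}" using n by simp
    ultimately show ?thesis using step[of 1 "\<lambda>u. \<alpha> u + real n * \<beta> u / d"] by argo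
  qed
qed

text \<open>A gap of \<open>1 / d\<close> ahead turns each term into
  \<open>\<alpha> u + \<beta> u / d\<close> plus the current position. For the last vehicle, vehicle
  \<open>1\<close> lies \<open>(n - 1) / d\<close> behind, and the extra
  \<open>n * \<beta> u / d\<close> restores the same gap.\<close>

lemma car_dynamics_equally_spaced:
  assumes U: "finite U" "U \<noteq> {}"
    and v: "v = (MIN u\<in>U. \<alpha> u + \<beta> u / d)"
  shows "car_dynamics U \<alpha> \<beta> n d (\<lambda>k i. real k * v + real i / d)"
proof -
  \<comment> \<open>Translation commutes with the minimum, so the update can be checked separately
    for each \<open>u\<close>.\<close>
  have shift: "v + c = (MIN u\<in>U. f u)"
    if "\<And>u. f u = \<alpha> u + \<beta> u / d + c" for f and c :: real
    using Min_add_commute[OF U, of "\<lambda>u. \<alpha> u + \<beta> u / d" c] by (simp add: v that)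
  have Suc: "real (Suc k) * v + real i / d = v + (real k * v + real i / d)" for k i
    by (simp add: algebra_simps)
  show ?thesis
    unfolding car_dynamics_def Suc
    by (intro allI conjI impI shift)
      (simp_all add: algebra_simps add_divide_distrib diff_divide_distrib)
qed

lemma bounded_diff_average_tendsto:
  fixes f g :: "nat \<Rightarrow> real"
  assumes g: "(\<lambda>k. g k / real k) \<longlonglongrightarrow> v" and bound: "\<And>k. \<bar>f k - g k\<bar> \<le> C"
  shows "(\<lambda>k. f k / real k) \<longlonglongrightarrow> v"
proof -
  have "(\<lambda>k. (f k - g k) / real k) \<longlonglongrightarrow> 0"
  proof (rule tendsto_0_le)
    show "(\<lambda>k. C / real k) \<longlonglongrightarrow> 0" by (rule lim_const_over_n)
    have "norm ((f k - g k) / real k) \<le> norm (C / real k) * 1" for k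
    proof -
      \<comment> \<open>At \<open>k = 0\<close> both quotients are \<open>0\<close>, so the estimate
        holds for every \<open>k\<close>.\<close>
      have "\<bar>f k - g k\<bar> \<le> \<bar>C\<bar>" using bound[of k] by linarith
      then show ?thesis by (simp add: divide_right_mono)
    qed
    then show "\<forall>\<^sub>F k in sequentially. norm ((f k - g k) / real k) \<le> norm (C / real k) * 1"
      by simp
  qed
  from tendsto_add[OF this g] show ?thesis by (simp add: diff_divide_distrib)
qed

lemma affine_average_tendsto:
  fixes v c :: real
  shows "(\<lambda>k. (real k * v + c) / real k) \<longlonglongrightarrow> v"
proof -
  have "(\<lambda>k. v + c / real k) \<longlonglongrightarrow> v + 0"
    by (intro tendsto_add tendsto_const lim_const_over_n)
  moreover have "\<forall>\<^sub>F k in sequentially. v + c / real k = (real k * v + c) / real k"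
    \<comment> \<open>At \<open>k = 0\<close> the left side is \<open>v\<close> and the right side
      is \<open>0\<close>, hence the restriction to positive \<open>k\<close>.\<close>
    using eventually_gt_at_top[of 0] by eventually_elim (simp add: field_simps)
  ultimately show ?thesis using tendsto_cong by fastforce
qed

theorem corollary3:
  fixes n :: nat and m d :: real and U :: "'u set" and \<alpha> \<beta> :: "'u \<Rightarrow> real"
  assumes "n \<ge> 1"
    and "m \<ge> real n"
    and "d = real n / m"
    and "finite U" and "U \<noteq> {}"
    and "\<And>u. u \<in> U \<Longrightarrow> \<beta> u \<in> {0..1}"
    and "\<exists>u\<in>U. \<beta> u \<in> {0<..1}"
  shows "\<exists>v. (\<forall>x. car_dynamics U \<alpha> \<beta> n d x \<longrightarrow> has_average_speed n x v) \<and>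
             average_flow d v = (MIN u\<in>U. \<alpha> u * d + \<beta> u)"
proof -
  define v where "v = (MIN u\<in>U. \<alpha> u + \<beta> u / d)"
  define y where "y = (\<lambda>k i. real k * v + real i / d)"
  have d: "d > 0" using assms(1-3) by simp
  have y: "car_dynamics U \<alpha> \<beta> n d y"
    unfolding y_def by (rule car_dynamics_equally_spaced[OF assms(4,5) v_def])
  have "has_average_speed n x v" if x: "car_dynamics U \<alpha> \<beta> n d x" for x
    unfolding has_average_speed_def
  proof
    fix i assume i: "i \<in> {1..n}"
    \<comment> \<open>The largest initial deviation depends on \<open>x\<close> but not on
      \<open>k\<close>, so it vanishes after division by time.\<close>
    define C where "C = (MAX j\<in>{1..n}. \<bar>x 0 j - y 0 j\<bar>)"
    have "\<bar>x 0 j - y 0 j\<bar> \<le> C" if "j \<in> {1..n}" for j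
      unfolding C_def using that by (intro Max_ge) auto
    from car_dynamics_nonexpansive[OF assms(4-6,1) x y this i]
    have bound: "\<bar>x k i - y k i\<bar> \<le> C" for k .
    have "(\<lambda>k. y k i / real k) \<longlonglongrightarrow> v"
      unfolding y_def by (rule affine_average_tendsto)
    then show "(\<lambda>k. x k i / real k) \<longlonglongrightarrow> v"
      using bound by (rule bounded_diff_average_tendsto)
  qed
  moreover have "average_flow d v = (MIN u\<in>U. \<alpha> u * d + \<beta> u)"
  proof -
    \<comment> \<open>Since \<open>d\<close> is positive, it can be moved inside the minimum and
      cancelled term by term.\<close>
    have "d * (\<alpha> u + \<beta> u / d) = \<alpha> u * d + \<beta> u" for u
      using d by (simp add: field_simps)
    then show ?thesis
      using Min_mult_left[OF assms(4,5), of d "\<lambda>u. \<alpha> u + \<beta> u / d"] d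
      by (simp only: average_flow_def v_def less_imp_le)
  qed
  ultimately show ?thesis by blast
qed

end
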